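(* Let $\mathbb{V}$ be a variety of universal algebras. The following conditions are equivalent: (i) the algebraic theory of $\mathbb{V}$ contains a group term; (ii) the algebraic theory of $\mathbb{V}$ contains protomodular terms with respect to which all $\mathbb{V}$-algebras are right-cancellable; (iii) the algebraic theory of $\mathbb{V}$ contains protomodular terms $\theta$, $\alpha_i$ and $e_i$ ($i=1,2,\dots,n$) such that $\theta$ is consociative and, moreover, $e_1=e_2=\dots=e_n$; (iv) the algebraic theory of $\mathbb{V}$ contains protomodular terms $\theta$ and $\alpha_i$ (with corresponding $e_i$; $i=1,2,\dots,n$) which satisfy the identity $$\theta\big(\alpha_1(a,b),\dots,\alpha_n(a,b),\theta(\alpha_1(c,d),\dots,\alpha_n(c,d),s)\big)=\theta\big(\alpha_1(q,d),\alpha_2(q,d),\dots,\alpha_n(q,d),s\big),$$ where $q=\theta(\alpha_1(a,b),\dots,\alpha_n(a,b),c)$.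
   Context: A group term of $\mathbb{V}$ is a binary term that satisfies the group identities for some unary term (inverse) and some 0-ary term (unit). Protomodular terms in the algebraic theory of $\mathbb{V}$ are, for some natural number $n\geq 1$: 0-ary terms $e_1,\dots,e_n$, binary terms $\alpha_1,\dots,\alpha_n$ and an $(n+1)$-ary term $\theta$ such that the identities $$\alpha_i(a,a)=e_i\quad (1\le i\le n),\qquad \theta(\alpha_1(a,b),\alpha_2(a,b),\dots,\alpha_n(a,b),b)=a$$ hold in $\mathbb{V}$. An algebra $A$ in $\mathbb{V}$ is right-cancellable with respect to protomodular terms $\theta,\alpha_i,e_i$ if for every $i$ ($1\le i\le n$) and all $a_1,\dots,a_n,a_1',\dots,a_n',b,b'\in A$ $$\alpha_i(\theta(a_1,\dots,a_n,b),\theta(a_1',\dots,a_n',b))=\alpha_i(\theta(a_1,\dots,a_n,b'),\theta(a_1',\dots,a_n',b')).$$ An $(n+1)$-ary term $\theta$ is consociative (2-associative) if it satisfies the identity $$\theta(a_1,\dots,a_n,\theta(b_1,\dots,b_n,c))=\theta(\theta(a_1,\dots,a_n,b_1),\theta(a_1,\dots,a_n,b_2),\dots,\theta(a_1,\dots,a_n,b_n),c).$$ *)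

theory Defs
  imports Main
begin

(* A signature is a set F of operation symbols with finite arities ar; F may be empty. *)

datatype 'f trm = Var nat | App 'f "'f trm list"

text \<open>\<open>trms F ar n\<close>: the n-ary terms, i.e. the well-formed terms in the variables
  \<open>Var 0, ..., Var (n - 1)\<close>; the 0-ary terms are the closed ones.\<close>

inductive_set trms :: "'f set \<Rightarrow> ('f \<Rightarrow> nat) \<Rightarrow> nat \<Rightarrow> 'f trm set"
  for F ar n where
  Var: "i < n \<Longrightarrow> Var i \<in> trms F ar n"
| App: "f \<in> F \<Longrightarrow> length ts = ar f \<Longrightarrow> (\<And>t. t \<in> set ts \<Longrightarrow> t \<in> trms F ar n)
    \<Longrightarrow> App f ts \<in> trms F ar n"

record ('f, 'u) algebra =
  carr :: "'u set"
  oper :: "'f \<Rightarrow> 'u list \<Rightarrow> 'u"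

definition is_algebra :: "'f set \<Rightarrow> ('f \<Rightarrow> nat) \<Rightarrow> ('f, 'u) algebra \<Rightarrow> bool" where
  "is_algebra F ar A \<longleftrightarrow>
    (\<forall>f\<in>F. \<forall>xs. length xs = ar f \<and> set xs \<subseteq> carr A \<longrightarrow> oper A f xs \<in> carr A)"

primrec eval :: "('f, 'u) algebra \<Rightarrow> (nat \<Rightarrow> 'u) \<Rightarrow> 'f trm \<Rightarrow> 'u" where
  "eval A \<rho> (Var i) = \<rho> i"
| "eval A \<rho> (App f ts) = oper A f (map (eval A \<rho>) ts)"

text \<open>The operation on A induced by an n-ary term, applied to a list of n arguments.\<close>

definition tm :: "('f, 'u) algebra \<Rightarrow> 'f trm \<Rightarrow> 'u list \<Rightarrow> 'u" where
  "tm A t xs = eval A (\<lambda>i. xs ! i) t"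

definition satisfies :: "('f, 'u) algebra \<Rightarrow> 'f trm \<Rightarrow> 'f trm \<Rightarrow> bool" where
  "satisfies A s t \<longleftrightarrow> (\<forall>\<rho>. range \<rho> \<subseteq> carr A \<longrightarrow> eval A \<rho> s = eval A \<rho> t)"

text \<open>A variety is the class of all algebras satisfying some set E of identities. The carriers
  range over the subsets of the type \<open>'u\<close>, which plays the role of the universe of sets and is
  left arbitrary. Once \<open>'u\<close> is large enough to contain a copy of the free algebra of countable
  rank, an identity holds in all members of \<open>\<V>\<close> iff it holds in all algebras satisfying E.\<close>

definition variety :: "'f set \<Rightarrow> ('f \<Rightarrow> nat) \<Rightarrow> ('f, 'u) algebra set \<Rightarrow> bool" where
  "variety F ar \<V> \<longleftrightarrow>
    (\<exists>E \<subseteq> (\<Union>n. trms F ar n \<times> trms F ar n).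
       \<V> = {A. is_algebra F ar A \<and> (\<forall>(s, t)\<in>E. satisfies A s t)})"

definition group_term :: "'f set \<Rightarrow> ('f \<Rightarrow> nat) \<Rightarrow> ('f, 'u) algebra set \<Rightarrow> 'f trm \<Rightarrow> bool" where
  "group_term F ar \<V> m \<longleftrightarrow> m \<in> trms F ar 2 \<and>
    (\<exists>v \<in> trms F ar 1. \<exists>e \<in> trms F ar 0. \<forall>A\<in>\<V>.
      (\<forall>a\<in>carr A. \<forall>b\<in>carr A. \<forall>c\<in>carr A. tm A m [tm A m [a, b], c] = tm A m [a, tm A m [b, c]]) \<and>
      (\<forall>a\<in>carr A. tm A m [tm A e [], a] = a \<and> tm A m [a, tm A e []] = a) \<and>
      (\<forall>a\<in>carr A. tm A m [tm A v [a], a] = tm A e [] \<and> tm A m [a, tm A v [a]] = tm A e []))"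

text \<open>The families of terms \<open>\<alpha>\<^sub>i\<close>, \<open>e\<^sub>i\<close> with \<open>1 \<le> i \<le> n\<close> are lists of length n, indexed from 0.
  \<open>tms A \<alpha> [a, b]\<close> is the list of all \<open>\<alpha>\<^sub>i(a, b)\<close>.\<close>

definition tms :: "('f, 'u) algebra \<Rightarrow> 'f trm list \<Rightarrow> 'u list \<Rightarrow> 'u list" where
  "tms A ts xs = map (\<lambda>t. tm A t xs) ts"

definition protomodular_terms ::
  "'f set \<Rightarrow> ('f \<Rightarrow> nat) \<Rightarrow> ('f, 'u) algebra set \<Rightarrow> nat \<Rightarrow> 'f trm \<Rightarrow> 'f trm list \<Rightarrow> 'f trm list \<Rightarrow> bool"
where
  "protomodular_terms F ar \<V> n \<theta> \<alpha> e \<longleftrightarrow> n \<ge> 1 \<and>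
    length e = n \<and> set e \<subseteq> trms F ar 0 \<and>
    length \<alpha> = n \<and> set \<alpha> \<subseteq> trms F ar 2 \<and>
    \<theta> \<in> trms F ar (n + 1) \<and>
    (\<forall>A\<in>\<V>. \<forall>a\<in>carr A. \<forall>i<n. tm A (\<alpha> ! i) [a, a] = tm A (e ! i) []) \<and>
    (\<forall>A\<in>\<V>. \<forall>a\<in>carr A. \<forall>b\<in>carr A. tm A \<theta> (tms A \<alpha> [a, b] @ [b]) = a)"

definition tuples :: "('f, 'u) algebra \<Rightarrow> nat \<Rightarrow> 'u list set" where
  "tuples A n = {as. length as = n \<and> set as \<subseteq> carr A}"

definition right_cancellable :: "('f, 'u) algebra \<Rightarrow> nat \<Rightarrow> 'f trm \<Rightarrow> 'f trm list \<Rightarrow> bool" where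
  "right_cancellable A n \<theta> \<alpha> \<longleftrightarrow>
    (\<forall>i<n. \<forall>as\<in>tuples A n. \<forall>as'\<in>tuples A n. \<forall>b\<in>carr A. \<forall>b'\<in>carr A.
      tm A (\<alpha> ! i) [tm A \<theta> (as @ [b]), tm A \<theta> (as' @ [b])]
      = tm A (\<alpha> ! i) [tm A \<theta> (as @ [b']), tm A \<theta> (as' @ [b'])])"

definition consociative :: "('f, 'u) algebra set \<Rightarrow> nat \<Rightarrow> 'f trm \<Rightarrow> bool" where
  "consociative \<V> n \<theta> \<longleftrightarrow>
    (\<forall>A\<in>\<V>. \<forall>as\<in>tuples A n. \<forall>bs\<in>tuples A n. \<forall>c\<in>carr A.
      tm A \<theta> (as @ [tm A \<theta> (bs @ [c])]) = tm A \<theta> (map (\<lambda>b. tm A \<theta> (as @ [b])) bs @ [c]))"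

end

theory Submission
  imports Defs
begin

text \<open>
  All four conditions say that certain terms satisfy certain identities, so the theorem comes down
  to finding the right terms and to a computation inside a single algebra.

  A group term \<open>m\<close> with inverse \<open>v\<close> is itself a family of protomodular terms with \<open>n = 1\<close>:
  take \<open>\<theta>(a, b) = a b\<close> and \<open>\<alpha>(a, b) = a b\<^sup>-\<^sup>1\<close>. Right cancellability, consociativity and the identity
  in (iv) are then the group identities \<open>(a b)(a' b)\<^sup>-\<^sup>1 = a a'\<^sup>-\<^sup>1\<close>, \<open>a (b c) = (a b) c\<close> and
  \<open>a b\<^sup>-\<^sup>1 (c d\<^sup>-\<^sup>1 s) = (a b\<^sup>-\<^sup>1 c) d\<^sup>-\<^sup>1 s\<close>.

  Conversely, choose a constant \<open>u\<close> among the \<open>e\<^sub>i\<close> and put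
  \<open>m(a, b) = \<theta>(\<alpha>\<^sub>1(a, u), \<dots>, \<alpha>\<^sub>n(a, u), b)\<close>: the list \<open>\<alpha>(a, u)\<close> is the translation that carries \<open>u\<close>
  to \<open>a\<close>, and \<open>m\<close> applies it to \<open>b\<close>. Any protomodular terms make \<open>u\<close> a two-sided unit of \<open>m\<close>. If
  moreover \<open>\<theta>(\<alpha>(a, b), s)\<close> depends on the translation \<open>\<alpha>(a, b)\<close> only through its value at \<open>u\<close>, then
  the value at \<open>u\<close> of the translation carrying \<open>a\<close> to \<open>u\<close> is a left inverse of \<open>a\<close>
  (\<open>translate_left_inverse\<close>). So an associative \<open>m\<close> with this factorisation is a group term
  (\<open>group_term_of_protomodular_terms\<close>). Both properties are instances of the identity in (iv), and
  both follow from consociativity when all \<open>e\<^sub>i\<close> are equal, because then \<open>m(a, b) = \<theta>(a, \<dots>, a, b)\<close>.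
  Right cancellability implies (iv) (\<open>right_cancellable_composition\<close>).
\<close>

section \<open>Composition of terms\<close>

lemma trms_mono: "t \<in> trms F ar m \<Longrightarrow> m \<le> n \<Longrightarrow> t \<in> trms F ar n"
  by (induction rule: trms.induct) (auto intro: trms.intros)

lemma eval_cong:
  assumes "t \<in> trms F ar n" and "\<And>i. i < n \<Longrightarrow> \<rho> i = \<rho>' i"
  shows "eval A \<rho> t = eval A \<rho>' t"
  using assms by (induction rule: trms.induct) (auto intro!: arg_cong[where f = "oper A _"])

lemma tm_closed_term: "t \<in> trms F ar 0 \<Longrightarrow> tm A t xs = tm A t []"
  unfolding tm_def by (rule eval_cong) auto

lemma tm_Var: "tm A (Var i) xs = xs ! i"
  by (simp add: tm_def)

lemma tm_in_carr:
  assumes "t \<in> trms F ar n" "is_algebra F ar A" "length xs = n" "set xs \<subseteq> carr A"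
  shows "tm A t xs \<in> carr A"
  using assms
proof (induction rule: trms.induct)
  case (Var i)
  then show ?case by (auto simp: tm_def)
next
  case (App f ts)
  then have "set (map (eval A (\<lambda>i. xs ! i)) ts) \<subseteq> carr A"
    by (auto simp: tm_def)
  with App show ?case
    by (simp add: tm_def is_algebra_def)
qed

primrec subst :: "(nat \<Rightarrow> 'f trm) \<Rightarrow> 'f trm \<Rightarrow> 'f trm" where
  "subst \<sigma> (Var i) = \<sigma> i"
| "subst \<sigma> (App f ts) = App f (map (subst \<sigma>) ts)"

definition compose :: "'f trm \<Rightarrow> 'f trm list \<Rightarrow> 'f trm" where
  "compose t us = subst (\<lambda>i. us ! i) t"

lemma eval_subst: "eval A \<rho> (subst \<sigma> t) = eval A (\<lambda>i. eval A \<rho> (\<sigma> i)) t"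
  by (induction t) (auto intro!: arg_cong[where f = "oper A _"])

lemma compose_in_trms:
  assumes "t \<in> trms F ar n" "length us = n" "set us \<subseteq> trms F ar k"
  shows "compose t us \<in> trms F ar k"
  using assms by (induction rule: trms.induct) (auto simp: compose_def intro!: trms.intros)

lemma tm_compose:
  assumes "t \<in> trms F ar n" "length us = n"
  shows "tm A (compose t us) xs = tm A t (tms A us xs)"
  unfolding tm_def compose_def eval_subst tms_def
  using assms by (auto intro!: eval_cong)

section \<open>Protomodular operations on a set\<close>

text \<open>
  The interpretation of protomodular terms in one algebra, together with a chosen element \<open>u\<close>.
  The lists \<open>\<alpha> a b\<close> collect the values of all \<open>\<alpha>\<^sub>i\<close>. It is useful to read an \<open>n\<close>-tuple \<open>as\<close> as the
  map \<open>\<theta> as\<close>, so that \<open>\<alpha> a b\<close> is a translation carrying \<open>b\<close> to \<open>a\<close>, and \<open>es\<close> is the identity.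
\<close>

locale protomodular_operations =
  fixes C :: "'u set" and n :: nat and \<theta> :: "'u list \<Rightarrow> 'u \<Rightarrow> 'u"
    and \<alpha> :: "'u \<Rightarrow> 'u \<Rightarrow> 'u list" and es :: "'u list" and u :: 'u
  assumes theta_closed: "length as = n \<Longrightarrow> set as \<subseteq> C \<Longrightarrow> b \<in> C \<Longrightarrow> \<theta> as b \<in> C"
    and alpha_length: "length (\<alpha> a b) = n"
    and alpha_closed: "a \<in> C \<Longrightarrow> b \<in> C \<Longrightarrow> set (\<alpha> a b) \<subseteq> C"
    and alpha_diag: "a \<in> C \<Longrightarrow> \<alpha> a a = es"
    and theta_alpha: "a \<in> C \<Longrightarrow> b \<in> C \<Longrightarrow> \<theta> (\<alpha> a b) b = a"
    and unit_closed: "u \<in> C"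
begin

definition translate :: "'u \<Rightarrow> 'u \<Rightarrow> 'u" where
  "translate a b = \<theta> (\<alpha> a u) b"

lemma theta_alpha_closed: "a \<in> C \<Longrightarrow> b \<in> C \<Longrightarrow> c \<in> C \<Longrightarrow> \<theta> (\<alpha> a b) c \<in> C"
  by (intro theta_closed alpha_length alpha_closed)

lemma es_tuple: "length es = n" "set es \<subseteq> C"
  using alpha_diag[OF unit_closed] alpha_length alpha_closed unit_closed by metis+

text \<open>The list \<open>\<alpha> b b\<close> is the same for all \<open>b\<close>, and it carries \<open>b\<close> to itself.\<close>

lemma theta_es: "b \<in> C \<Longrightarrow> \<theta> es b = b"
  using theta_alpha[of b b] alpha_diag[of b] by simp

lemma translate_unit_left: "b \<in> C \<Longrightarrow> translate u b = b"
  using theta_es alpha_diag[OF unit_closed] by (simp add: translate_def)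

lemma translate_unit_right: "a \<in> C \<Longrightarrow> translate a u = a"
  using theta_alpha unit_closed by (simp add: translate_def)

text \<open>
  If a translation is determined by its value at \<open>u\<close>, then the translation by
  \<open>\<theta> (\<alpha> u a) u\<close> is the map \<open>\<theta> (\<alpha> u a)\<close>, which carries \<open>a\<close> to \<open>u\<close>.
\<close>

lemma translate_left_inverse:
  assumes factor: "\<And>a b s. a \<in> C \<Longrightarrow> b \<in> C \<Longrightarrow> s \<in> C \<Longrightarrow>
      translate (\<theta> (\<alpha> a b) u) s = \<theta> (\<alpha> a b) s"
    and "a \<in> C"
  shows "translate (\<theta> (\<alpha> u a) u) a = u"
  using factor[of u a a] theta_alpha[of u a] assms(2) unit_closed by simp

text \<open>
  In tuple form, right cancellability says that \<open>\<alpha> (\<theta> as b) (\<theta> as' b)\<close> does not depend on \<open>b\<close>.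
  Since \<open>x = \<theta> (\<alpha> x z) z\<close>, an element \<open>x\<close> is known once \<open>\<alpha> x z\<close> is known for some \<open>z\<close>. With \<open>x\<close> the
  right side of the identity and \<open>z = \<theta> (\<alpha> c d) s\<close>, moving the base point first from \<open>s\<close> to \<open>d\<close>
  and then from \<open>c\<close> to \<open>b\<close> gives \<open>\<alpha> x z = \<alpha> q c = \<alpha> a b\<close>.
\<close>

lemma right_cancellable_composition:
  assumes rc: "\<And>as as' b b'. length as = n \<Longrightarrow> set as \<subseteq> C \<Longrightarrow> length as' = n \<Longrightarrow> set as' \<subseteq> C
      \<Longrightarrow> b \<in> C \<Longrightarrow> b' \<in> C \<Longrightarrow> \<alpha> (\<theta> as b) (\<theta> as' b) = \<alpha> (\<theta> as b') (\<theta> as' b')"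
    and C: "a \<in> C" "b \<in> C" "c \<in> C" "d \<in> C" "s \<in> C"
  shows "\<theta> (\<alpha> a b) (\<theta> (\<alpha> c d) s) = \<theta> (\<alpha> (\<theta> (\<alpha> a b) c) d) s"
proof -
  define q where "q = \<theta> (\<alpha> a b) c"
  define z where "z = \<theta> (\<alpha> c d) s"
  define x where "x = \<theta> (\<alpha> q d) s"
  have q: "q \<in> C" and z: "z \<in> C" and x: "x \<in> C"
    using C by (auto simp: q_def z_def x_def intro!: theta_alpha_closed)
  have "\<alpha> x z = \<alpha> (\<theta> (\<alpha> q d) d) (\<theta> (\<alpha> c d) d)"
    unfolding x_def z_def using C q by (intro rc alpha_length alpha_closed)
  also have "\<dots> = \<alpha> q c"
    using C q by (simp add: theta_alpha)
  also have "\<dots> = \<alpha> (\<theta> (\<alpha> a b) c) (\<theta> es c)"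
    using C by (simp add: q_def theta_es)
  also have "\<dots> = \<alpha> (\<theta> (\<alpha> a b) b) (\<theta> es b)"
    using C by (intro rc alpha_length alpha_closed es_tuple)
  also have "\<dots> = \<alpha> a b"
    using C by (simp add: theta_alpha theta_es)
  finally have "x = \<theta> (\<alpha> a b) z"
    using theta_alpha[OF x z] by simp
  then show ?thesis
    by (simp add: x_def z_def q_def)
qed

end

text \<open>
  When all \<open>e\<^sub>i\<close> equal \<open>u\<close>, composing a tuple \<open>as\<close> with \<open>es\<close> entrywise gives the constant tuple with
  entry \<open>\<theta> as u\<close>, and consociativity says that this constant tuple acts like \<open>as\<close>.
\<close>

locale consociative_operations = protomodular_operations +
  assumes es_const: "es = replicate n u"
    and consoc: "length as = n \<Longrightarrow> set as \<subseteq> C \<Longrightarrow> length bs = n \<Longrightarrow> set bs \<subseteq> C \<Longrightarrow> c \<in> C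
      \<Longrightarrow> \<theta> as (\<theta> bs c) = \<theta> (map (\<theta> as) bs) c"
begin

lemma theta_constant_tuple:
  assumes "length as = n" "set as \<subseteq> C" "c \<in> C"
  shows "\<theta> (replicate n (\<theta> as u)) c = \<theta> as c"
  using consoc[OF assms(1,2) es_tuple assms(3)] theta_es[OF assms(3)]
  by (simp add: es_const)

lemma translate_constant_tuple:
  assumes "a \<in> C" "c \<in> C"
  shows "translate a c = \<theta> (replicate n a) c"
  using theta_constant_tuple[OF alpha_length alpha_closed, of a u c] theta_alpha[of a u]
    assms unit_closed
  by (simp add: translate_def)

lemma translate_factor:
  assumes "length as = n" "set as \<subseteq> C" "c \<in> C"
  shows "translate (\<theta> as u) c = \<theta> as c"
  using translate_constant_tuple[OF theta_closed] theta_constant_tuple assms unit_closed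
  by simp

lemma translate_assoc:
  assumes "a \<in> C" "b \<in> C" "c \<in> C"
  shows "translate (translate a b) c = translate a (translate b c)"
proof -
  have "translate a b \<in> C"
    using assms unit_closed by (simp add: translate_def theta_alpha_closed)
  then have "translate (translate a b) c = \<theta> (map (\<theta> (\<alpha> a u)) (replicate n b)) c"
    using assms by (simp add: translate_constant_tuple[of "translate a b"]) (simp add: translate_def)
  also have "\<dots> = \<theta> (\<alpha> a u) (\<theta> (replicate n b) c)"
    using assms unit_closed by (intro consoc[symmetric] alpha_length alpha_closed) auto
  also have "\<dots> = translate a (translate b c)"
    using assms by (simp add: translate_constant_tuple[of b]) (simp add: translate_def)
  finally show ?thesis .
qed

end

section \<open>Protomodular terms and group terms\<close>

lemma variety_is_algebra: "variety F ar \<V> \<Longrightarrow> A \<in> \<V> \<Longrightarrow> is_algebra F ar A"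
  by (auto simp: variety_def)

lemma protomodular_operations_tm:
  assumes "variety F ar \<V>" "A \<in> \<V>" and pt: "protomodular_terms F ar \<V> n \<theta> \<alpha> e"
  shows "protomodular_operations (carr A) n (\<lambda>as b. tm A \<theta> (as @ [b]))
    (\<lambda>a b. tms A \<alpha> [a, b]) (tms A e []) (tm A (e ! 0) [])"
proof -
  have alg: "is_algebra F ar A"
    using assms variety_is_algebra by blast
  have \<alpha>: "tm A t [a, b] \<in> carr A" if "t \<in> set \<alpha>" "a \<in> carr A" "b \<in> carr A" for t a b
    using pt that by (intro tm_in_carr[OF _ alg, of _ 2]) (auto simp: protomodular_terms_def)
  show ?thesis
  proof
    fix as b assume "length as = n" "set as \<subseteq> carr A" "b \<in> carr A"
    then show "tm A \<theta> (as @ [b]) \<in> carr A"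
      using pt by (intro tm_in_carr[OF _ alg, of _ "n + 1"]) (auto simp: protomodular_terms_def)
  next
    have "e ! 0 \<in> trms F ar 0"
      using pt nth_mem[of 0 e] unfolding protomodular_terms_def
      by (metis One_nat_def less_eq_Suc_le subsetD)
    then show "tm A (e ! 0) [] \<in> carr A"
      by (rule tm_in_carr[OF _ alg]) auto
  next
    fix a assume "a \<in> carr A"
    then show "tms A \<alpha> [a, a] = tms A e []"
      using pt \<open>A \<in> \<V>\<close> by (auto simp: protomodular_terms_def tms_def intro!: nth_equalityI)
  qed (use pt \<open>A \<in> \<V>\<close> \<alpha> in \<open>auto simp: protomodular_terms_def tms_def\<close>)
qed

lemma left_inverse_imp_right_inverse:
  assumes closed: "\<And>a b. a \<in> C \<Longrightarrow> b \<in> C \<Longrightarrow> m a b \<in> C" "\<And>a. a \<in> C \<Longrightarrow> v a \<in> C"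
    and assoc: "\<And>a b c. a \<in> C \<Longrightarrow> b \<in> C \<Longrightarrow> c \<in> C \<Longrightarrow> m (m a b) c = m a (m b c)"
    and unit: "\<And>a. a \<in> C \<Longrightarrow> m u a = a"
    and inv: "\<And>a. a \<in> C \<Longrightarrow> m (v a) a = u"
    and a: "a \<in> C"
  shows "m a (v a) = u"
proof -
  note C = a closed(2)[OF a] closed(2)[OF closed(2)[OF a]]
  have "m a (v a) = m (m (v (v a)) (v a)) (m a (v a))"
    using C by (simp add: inv unit closed)
  also have "\<dots> = m (v (v a)) (m (m (v a) a) (v a))"
    using C by (simp add: assoc closed)
  also have "\<dots> = u"
    using C by (simp add: inv unit)
  finally show ?thesis .
qed

text \<open>
  With \<open>u\<close> the first of the constants \<open>e\<^sub>i\<close>, the group term is \<open>m(a, b) = \<theta>(\<alpha>(a, u), b)\<close>. Its inverse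
  term is \<open>v(a) = \<theta>(\<alpha>(u, a), u)\<close>: the factorisation of translations through their value at \<open>u\<close>
  makes \<open>v(a)\<close> a left inverse of \<open>a\<close>, and in an associative setting with a left unit such an
  inverse is two-sided.
\<close>

lemma group_term_of_protomodular_terms:
  fixes \<V> :: "('f, 'u) algebra set" and \<theta> :: "'f trm" and \<alpha> e :: "'f trm list"
  defines "mult \<equiv> \<lambda>A a b. tm A \<theta> (tms A \<alpha> [a, tm A (e ! 0) []] @ [b])"
  assumes var: "variety F ar \<V>" and pt: "protomodular_terms F ar \<V> n \<theta> \<alpha> e"
    and assoc: "\<And>A a b c. A \<in> \<V> \<Longrightarrow> a \<in> carr A \<Longrightarrow> b \<in> carr A \<Longrightarrow> c \<in> carr A \<Longrightarrow>
      mult A (mult A a b) c = mult A a (mult A b c)"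
    and factor: "\<And>A a b s. A \<in> \<V> \<Longrightarrow> a \<in> carr A \<Longrightarrow> b \<in> carr A \<Longrightarrow> s \<in> carr A \<Longrightarrow>
      mult A (tm A \<theta> (tms A \<alpha> [a, b] @ [tm A (e ! 0) []])) s = tm A \<theta> (tms A \<alpha> [a, b] @ [s])"
  shows "\<exists>m. group_term F ar \<V> m"
proof -
  define u where "u = e ! 0"
  define m where "m = compose \<theta> (map (\<lambda>t. compose t [Var 0, u]) \<alpha> @ [Var 1])"
  define v where "v = compose \<theta> (map (\<lambda>t. compose t [u, Var 0]) \<alpha> @ [u])"
  have \<theta>: "\<theta> \<in> trms F ar (n + 1)" and \<alpha>: "length \<alpha> = n" "\<And>t. t \<in> set \<alpha> \<Longrightarrow> t \<in> trms F ar 2"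
    using pt by (auto simp: protomodular_terms_def)
  have u: "u \<in> trms F ar 0"
    using pt nth_mem[of 0 e] unfolding protomodular_terms_def u_def
    by (metis One_nat_def less_eq_Suc_le subsetD)
  then have u': "u \<in> trms F ar k" for k
    by (rule trms_mono) simp
  have m: "m \<in> trms F ar 2"
    unfolding m_def using \<alpha> u'
    by (auto intro!: compose_in_trms[OF \<theta>] compose_in_trms[OF \<alpha>(2)] trms.Var)
  have v: "v \<in> trms F ar 1"
    unfolding v_def using \<alpha> u'
    by (auto intro!: compose_in_trms[OF \<theta>] compose_in_trms[OF \<alpha>(2)] trms.Var)
  have tm_m: "tm A m [a, b] = mult A a b" for A :: "('f, 'u) algebra" and a b
  proof -
    have "tms A (map (\<lambda>t. compose t [Var 0, u]) \<alpha> @ [Var 1]) [a, b] = tms A \<alpha> [a, tm A u []] @ [b]"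
      by (auto simp: tms_def tm_compose[OF \<alpha>(2)] tm_Var tm_closed_term[OF u, of A "[a, b]"])
    then show ?thesis
      using \<alpha>(1) by (simp add: m_def tm_compose[OF \<theta>] mult_def u_def)
  qed
  have tm_v: "tm A v [a] = tm A \<theta> (tms A \<alpha> [tm A u [], a] @ [tm A u []])"
    for A :: "('f, 'u) algebra" and a
  proof -
    have "tms A (map (\<lambda>t. compose t [u, Var 0]) \<alpha> @ [u]) [a]
        = tms A \<alpha> [tm A u [], a] @ [tm A u []]"
      by (auto simp: tms_def tm_compose[OF \<alpha>(2)] tm_Var tm_closed_term[OF u, of A "[a]"])
    then show ?thesis
      using \<alpha>(1) by (simp add: v_def tm_compose[OF \<theta>])
  qed
  have "(\<forall>a\<in>carr A. \<forall>b\<in>carr A. \<forall>c\<in>carr A.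
         tm A m [tm A m [a, b], c] = tm A m [a, tm A m [b, c]]) \<and>
      (\<forall>a\<in>carr A. tm A m [tm A u [], a] = a \<and> tm A m [a, tm A u []] = a) \<and>
      (\<forall>a\<in>carr A. tm A m [tm A v [a], a] = tm A u [] \<and> tm A m [a, tm A v [a]] = tm A u [])"
    if A: "A \<in> \<V>" for A
  proof -
    interpret P: protomodular_operations "carr A" n "\<lambda>as b. tm A \<theta> (as @ [b])"
      "\<lambda>a b. tms A \<alpha> [a, b]" "tms A e []" "tm A u []"
      unfolding u_def by (rule protomodular_operations_tm[OF var A pt])
    have mult: "mult A = P.translate"
      by (intro ext) (simp add: mult_def P.translate_def flip: u_def)
    have left_inv: "tm A m [tm A v [a], a] = tm A u []" if "a \<in> carr A" for a
      unfolding tm_m mult tm_v using that factor[OF A] P.unit_closed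
      by (intro P.translate_left_inverse) (auto simp: mult u_def)
    have "tm A m [a, tm A v [a]] = tm A u []" if "a \<in> carr A" for a
    proof (rule left_inverse_imp_right_inverse
        [where C = "carr A" and m = "\<lambda>a b. tm A m [a, b]" and v = "\<lambda>a. tm A v [a]"])
      show "tm A m [a, b] \<in> carr A" if "a \<in> carr A" "b \<in> carr A" for a b
        using that P.unit_closed by (simp add: tm_m mult P.translate_def P.theta_alpha_closed)
      show "tm A v [a] \<in> carr A" if "a \<in> carr A" for a
        using that P.unit_closed by (simp add: tm_v P.theta_alpha_closed)
    qed (use that assoc[OF A] left_inv P.translate_unit_left in \<open>auto simp: tm_m mult\<close>)
    then show ?thesis
      using left_inv assoc[OF A] P.translate_unit_left P.translate_unit_right
      by (auto simp: tm_m mult)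
  qed
  with m v u show ?thesis
    unfolding group_term_def by blast
qed

text \<open>
  With \<open>b = d = u\<close> the identity is associativity of \<open>m\<close>. With \<open>c = d = u\<close> the inner application of
  \<open>\<theta>\<close> disappears, since \<open>\<theta>(e\<^sub>1, \<dots>, e\<^sub>n, s) = s\<close>, and the factorisation of translations remains.
\<close>

lemma composition_identity_imp_group_term:
  fixes \<V> :: "('f, 'u) algebra set"
  assumes var: "variety F ar \<V>" and pt: "protomodular_terms F ar \<V> n \<theta> \<alpha> e"
    and comp: "\<And>A a b c d s. A \<in> \<V> \<Longrightarrow> a \<in> carr A \<Longrightarrow> b \<in> carr A \<Longrightarrow> c \<in> carr A \<Longrightarrow>
      d \<in> carr A \<Longrightarrow> s \<in> carr A \<Longrightarrow>
      tm A \<theta> (tms A \<alpha> [a, b] @ [tm A \<theta> (tms A \<alpha> [c, d] @ [s])])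
      = tm A \<theta> (tms A \<alpha> [tm A \<theta> (tms A \<alpha> [a, b] @ [c]), d] @ [s])"
  shows "\<exists>m. group_term F ar \<V> m"
proof (rule group_term_of_protomodular_terms[OF var pt])
  fix A a b c assume A: "A \<in> \<V>" and C: "a \<in> carr A" "b \<in> carr A" "c \<in> carr A"
  interpret P: protomodular_operations "carr A" n "\<lambda>as b. tm A \<theta> (as @ [b])"
    "\<lambda>a b. tms A \<alpha> [a, b]" "tms A e []" "tm A (e ! 0) []"
    by (rule protomodular_operations_tm[OF var A pt])
  let ?u = "tm A (e ! 0) []"
  show "tm A \<theta> (tms A \<alpha> [tm A \<theta> (tms A \<alpha> [a, ?u] @ [b]), ?u] @ [c])
      = tm A \<theta> (tms A \<alpha> [a, ?u] @ [tm A \<theta> (tms A \<alpha> [b, ?u] @ [c])])"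
    using comp[OF A, of a ?u b ?u c] C P.unit_closed by simp
  show "tm A \<theta> (tms A \<alpha> [tm A \<theta> (tms A \<alpha> [a, b] @ [?u]), ?u] @ [c])
      = tm A \<theta> (tms A \<alpha> [a, b] @ [c])"
    using comp[OF A, of a b ?u ?u c] C P.unit_closed P.alpha_diag[of ?u] P.theta_es[of c] by simp
qed

lemma consociative_imp_group_term:
  fixes \<V> :: "('f, 'u) algebra set"
  assumes var: "variety F ar \<V>" and pt: "protomodular_terms F ar \<V> n \<theta> \<alpha> e"
    and consoc: "consociative \<V> n \<theta>"
    and const: "\<And>A i j. A \<in> \<V> \<Longrightarrow> i < n \<Longrightarrow> j < n \<Longrightarrow> tm A (e ! i) [] = tm A (e ! j) []"
  shows "\<exists>m. group_term F ar \<V> m"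
proof (rule group_term_of_protomodular_terms[OF var pt])
  fix A a b c assume A: "A \<in> \<V>" and C: "a \<in> carr A" "b \<in> carr A" "c \<in> carr A"
  let ?u = "tm A (e ! 0) []"
  interpret P: consociative_operations "carr A" n "\<lambda>as b. tm A \<theta> (as @ [b])"
    "\<lambda>a b. tms A \<alpha> [a, b]" "tms A e []" ?u
  proof (intro consociative_operations.intro consociative_operations_axioms.intro
      protomodular_operations_tm[OF var A pt])
    show "tms A e [] = replicate n ?u"
    proof (rule nth_equalityI)
      show "tms A e [] ! i = replicate n ?u ! i" if "i < length (tms A e [])" for i
        using that const[OF A, of i 0] pt by (simp add: tms_def protomodular_terms_def)
    qed (use pt in \<open>simp add: tms_def protomodular_terms_def\<close>)
  qed (use consoc A in \<open>auto simp: consociative_def tuples_def\<close>)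
  show "tm A \<theta> (tms A \<alpha> [tm A \<theta> (tms A \<alpha> [a, ?u] @ [b]), ?u] @ [c])
      = tm A \<theta> (tms A \<alpha> [a, ?u] @ [tm A \<theta> (tms A \<alpha> [b, ?u] @ [c])])"
    using P.translate_assoc[OF C] by (simp add: P.translate_def)
  show "tm A \<theta> (tms A \<alpha> [tm A \<theta> (tms A \<alpha> [a, b] @ [?u]), ?u] @ [c])
      = tm A \<theta> (tms A \<alpha> [a, b] @ [c])"
    using P.translate_factor[OF P.alpha_length P.alpha_closed, of a b c] C
    by (simp add: P.translate_def)
qed

lemma right_cancellable_imp_composition_identity:
  assumes var: "variety F ar \<V>" and pt: "protomodular_terms F ar \<V> n \<theta> \<alpha> e"
    and A: "A \<in> \<V>" and rc: "right_cancellable A n \<theta> \<alpha>"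
    and C: "a \<in> carr A" "b \<in> carr A" "c \<in> carr A" "d \<in> carr A" "s \<in> carr A"
  shows "tm A \<theta> (tms A \<alpha> [a, b] @ [tm A \<theta> (tms A \<alpha> [c, d] @ [s])])
      = tm A \<theta> (tms A \<alpha> [tm A \<theta> (tms A \<alpha> [a, b] @ [c]), d] @ [s])"
proof -
  interpret P: protomodular_operations "carr A" n "\<lambda>as b. tm A \<theta> (as @ [b])"
    "\<lambda>a b. tms A \<alpha> [a, b]" "tms A e []" "tm A (e ! 0) []"
    by (rule protomodular_operations_tm[OF var A pt])
  have len: "length \<alpha> = n"
    using pt by (simp add: protomodular_terms_def)
  have "tms A \<alpha> [tm A \<theta> (as @ [x]), tm A \<theta> (as' @ [x])]
      = tms A \<alpha> [tm A \<theta> (as @ [y]), tm A \<theta> (as' @ [y])]"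
    if "length as = n" "set as \<subseteq> carr A" "length as' = n" "set as' \<subseteq> carr A"
      "x \<in> carr A" "y \<in> carr A" for as as' x y
  proof (rule nth_equalityI)
    fix i assume "i < length (tms A \<alpha> [tm A \<theta> (as @ [x]), tm A \<theta> (as' @ [x])])"
    then have "i < n" by (simp add: tms_def len)
    have "as \<in> tuples A n" "as' \<in> tuples A n"
      using that by (auto simp: tuples_def)
    with \<open>i < n\<close> that(5,6) rc
    have "tm A (\<alpha> ! i) [tm A \<theta> (as @ [x]), tm A \<theta> (as' @ [x])]
        = tm A (\<alpha> ! i) [tm A \<theta> (as @ [y]), tm A \<theta> (as' @ [y])]"
      unfolding right_cancellable_def by blast
    then show "tms A \<alpha> [tm A \<theta> (as @ [x]), tm A \<theta> (as' @ [x])] ! i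
        = tms A \<alpha> [tm A \<theta> (as @ [y]), tm A \<theta> (as' @ [y])] ! i"
      using \<open>i < n\<close> by (simp add: tms_def len)
  qed (simp add: tms_def)
  then show ?thesis
    using C by (rule P.right_cancellable_composition)
qed

text \<open>
  The protomodular terms of a group are \<open>\<theta>(a, b) = a b\<close>, \<open>\<alpha>(a, b) = a b\<^sup>-\<^sup>1\<close> and the unit, and this
  one choice serves all three conditions. For \<open>n = 1\<close>, consociativity is associativity.
\<close>

lemma group_term_imp_protomodular_terms:
  fixes \<V> :: "('f, 'u) algebra set"
  assumes var: "variety F ar \<V>" and group: "group_term F ar \<V> m"
  obtains \<alpha> e where "protomodular_terms F ar \<V> 1 m [\<alpha>] [e]"
    and "\<And>A. A \<in> \<V> \<Longrightarrow> right_cancellable A 1 m [\<alpha>]"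
    and "consociative \<V> 1 m"
    and "\<And>A a b c d s. A \<in> \<V> \<Longrightarrow> a \<in> carr A \<Longrightarrow> b \<in> carr A \<Longrightarrow> c \<in> carr A \<Longrightarrow>
      d \<in> carr A \<Longrightarrow> s \<in> carr A \<Longrightarrow>
      tm A m (tms A [\<alpha>] [a, b] @ [tm A m (tms A [\<alpha>] [c, d] @ [s])])
      = tm A m (tms A [\<alpha>] [tm A m (tms A [\<alpha>] [a, b] @ [c]), d] @ [s])"
proof -
  from group obtain v e where m: "m \<in> trms F ar 2" and v: "v \<in> trms F ar 1" and e: "e \<in> trms F ar 0"
    and assoc: "\<And>A a b c. A \<in> \<V> \<Longrightarrow> a \<in> carr A \<Longrightarrow> b \<in> carr A \<Longrightarrow> c \<in> carr A \<Longrightarrow>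
      tm A m [tm A m [a, b], c] = tm A m [a, tm A m [b, c]]"
    and unit: "\<And>A a. A \<in> \<V> \<Longrightarrow> a \<in> carr A \<Longrightarrow> tm A m [tm A e [], a] = a"
      "\<And>A a. A \<in> \<V> \<Longrightarrow> a \<in> carr A \<Longrightarrow> tm A m [a, tm A e []] = a"
    and inv: "\<And>A a. A \<in> \<V> \<Longrightarrow> a \<in> carr A \<Longrightarrow> tm A m [tm A v [a], a] = tm A e []"
      "\<And>A a. A \<in> \<V> \<Longrightarrow> a \<in> carr A \<Longrightarrow> tm A m [a, tm A v [a]] = tm A e []"
    unfolding group_term_def by blast
  define \<alpha> where "\<alpha> = compose m [Var 0, compose v [Var 1]]"
  have v1: "compose v [Var 1] \<in> trms F ar 2"
    by (rule compose_in_trms[OF v]) (auto intro: trms.Var)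
  then have \<alpha>: "\<alpha> \<in> trms F ar 2"
    unfolding \<alpha>_def by (intro compose_in_trms[OF m]) (auto intro: trms.Var)
  have tm_\<alpha>: "tm A \<alpha> [a, b] = tm A m [a, tm A v [b]]" for A :: "('f, 'u) algebra" and a b
    by (simp add: \<alpha>_def tm_compose[OF m] tm_compose[OF v] tms_def tm_Var)
  have m_closed: "tm A m [a, b] \<in> carr A" if "A \<in> \<V>" "a \<in> carr A" "b \<in> carr A" for A a b
    using that by (intro tm_in_carr[OF m variety_is_algebra[OF var]]) auto
  have v_closed: "tm A v [a] \<in> carr A" if "A \<in> \<V>" "a \<in> carr A" for A a
    using that by (intro tm_in_carr[OF v variety_is_algebra[OF var]]) auto
  note closed = m_closed v_closed
  show thesis
  proof
    show "protomodular_terms F ar \<V> 1 m [\<alpha>] [e]"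
      using m \<alpha> e
      by (auto simp: protomodular_terms_def tm_\<alpha> tms_def inv unit assoc closed numeral_2_eq_2)
  next
    show "consociative \<V> 1 m"
      by (auto simp: consociative_def tuples_def length_Suc_conv assoc)
  next
    show "right_cancellable A 1 m [\<alpha>]" if A: "A \<in> \<V>" for A
    proof -
      (* The base point drops out: (a b)(a' b)^-1 = a a'^-1. To see this, write
         a b = (a a'^-1)(a' b) and multiply by (a' b)^-1 on the right. *)
      have "tm A \<alpha> [tm A m [a, b], tm A m [a', b]] = tm A \<alpha> [a, a']"
        if C: "a \<in> carr A" "a' \<in> carr A" "b \<in> carr A" for a a' b
      proof -
        define q where "q = tm A \<alpha> [a, a']"
        have q: "q \<in> carr A"
          using A C by (simp add: q_def tm_\<alpha> closed)
        have "tm A m [q, a'] = a"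
          using A C by (simp add: q_def tm_\<alpha> assoc closed inv unit)
        then have "tm A m [a, b] = tm A m [q, tm A m [a', b]]"
          using assoc[OF A q C(2,3)] by simp
        then have "tm A \<alpha> [tm A m [a, b], tm A m [a', b]] = q"
          using A C q by (simp add: tm_\<alpha> assoc closed inv unit)
        then show ?thesis
          by (simp add: q_def)
      qed
      then show ?thesis
        by (auto simp: right_cancellable_def tuples_def length_Suc_conv)
    qed
  next
    show "tm A m (tms A [\<alpha>] [a, b] @ [tm A m (tms A [\<alpha>] [c, d] @ [s])])
      = tm A m (tms A [\<alpha>] [tm A m (tms A [\<alpha>] [a, b] @ [c]), d] @ [s])"
      if "A \<in> \<V>" "a \<in> carr A" "b \<in> carr A" "c \<in> carr A" "d \<in> carr A" "s \<in> carr A"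
      for A a b c d s
      using that by (simp add: tms_def tm_\<alpha> assoc closed)
  qed
qed

section \<open>The equivalence\<close>

theorem theorem5p5:
  fixes F :: "'f set" and ar :: "'f \<Rightarrow> nat" and \<V> :: "('f, 'u) algebra set"
  assumes "variety F ar \<V>"
  defines "cond_i \<equiv> (\<exists>m. group_term F ar \<V> m)"
    and "cond_ii \<equiv> (\<exists>n \<theta> \<alpha> e. protomodular_terms F ar \<V> n \<theta> \<alpha> e \<and>
           (\<forall>A\<in>\<V>. right_cancellable A n \<theta> \<alpha>))"
    and "cond_iii \<equiv> (\<exists>n \<theta> \<alpha> e. protomodular_terms F ar \<V> n \<theta> \<alpha> e \<and>
           consociative \<V> n \<theta> \<and>
           (\<forall>A\<in>\<V>. \<forall>i<n. \<forall>j<n. tm A (e ! i) [] = tm A (e ! j) []))"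
    and "cond_iv \<equiv> (\<exists>n \<theta> \<alpha> e. protomodular_terms F ar \<V> n \<theta> \<alpha> e \<and>
           (\<forall>A\<in>\<V>. \<forall>a\<in>carr A. \<forall>b\<in>carr A. \<forall>c\<in>carr A. \<forall>d\<in>carr A. \<forall>s\<in>carr A.
              let q = tm A \<theta> (tms A \<alpha> [a, b] @ [c]) in
              tm A \<theta> (tms A \<alpha> [a, b] @ [tm A \<theta> (tms A \<alpha> [c, d] @ [s])])
              = tm A \<theta> (tms A \<alpha> [q, d] @ [s])))"
  shows "(cond_i \<longleftrightarrow> cond_ii) \<and> (cond_i \<longleftrightarrow> cond_iii) \<and> (cond_i \<longleftrightarrow> cond_iv)"
proof -
  note var = assms(1)
  have i_imp: "cond_ii \<and> cond_iii \<and> cond_iv" if cond_i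
  proof -
    from that obtain m where "group_term F ar \<V> m"
      unfolding cond_i_def by blast
    from group_term_imp_protomodular_terms[OF var this] obtain \<alpha> e where
      pt: "protomodular_terms F ar \<V> 1 m [\<alpha>] [e]"
      and ii: "\<And>A. A \<in> \<V> \<Longrightarrow> right_cancellable A 1 m [\<alpha>]"
      and iii: "consociative \<V> 1 m"
      and iv: "\<And>A a b c d s. A \<in> \<V> \<Longrightarrow> a \<in> carr A \<Longrightarrow> b \<in> carr A \<Longrightarrow> c \<in> carr A \<Longrightarrow>
        d \<in> carr A \<Longrightarrow> s \<in> carr A \<Longrightarrow>
        tm A m (tms A [\<alpha>] [a, b] @ [tm A m (tms A [\<alpha>] [c, d] @ [s])])
        = tm A m (tms A [\<alpha>] [tm A m (tms A [\<alpha>] [a, b] @ [c]), d] @ [s])"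
      by blast
    have cond_ii
      unfolding cond_ii_def using pt ii by blast
    moreover have cond_iii
      unfolding cond_iii_def
      by (rule exI[of _ 1], rule exI[of _ m], rule exI[of _ "[\<alpha>]"], rule exI[of _ "[e]"])
        (use pt iii in simp)
    moreover have cond_iv
      unfolding cond_iv_def Let_def using pt iv by blast
    ultimately show ?thesis by blast
  qed
  have iv_i: cond_i if cond_iv
    using that composition_identity_imp_group_term[OF var]
    unfolding cond_i_def cond_iv_def Let_def by blast
  have ii_iv: cond_iv if cond_ii
    using that right_cancellable_imp_composition_identity[OF var]
    unfolding cond_ii_def cond_iv_def Let_def by blast
  have iii_i: cond_i if cond_iii
    using that consociative_imp_group_term[OF var]
    unfolding cond_i_def cond_iii_def by blast
  from i_imp iv_i ii_iv iii_i show ?thesis by blast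
qed

end
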